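(* Let $(G,w,c)$ be an instance of the network bargaining game, with $\mathcal{C}$ and $\mathcal{K}$ the core and prekernel of the associated matching game. Let $x\in\mathcal{C}$ and let $(M,z)$ be a corresponding stable solution, so that $x_u=\sum_{v:\,uv\in M}z_{uv}$ for all $u\in V(G)$. Suppose that (1) $M$ is acyclic, and (2) there are no bad vertices in the solution $(M,z)$. Then $(M,z)$ is a balanced solution if and only if $x\in\mathcal{K}$.
   Context: An instance of the network bargaining game is a triple $(G,w,c)$ where $G$ is a finite undirected graph (no loops or parallel edges), $w\in\mathbb{R}_+^{|E(G)|}$ is a vector of nonnegative edge weights and $c\in\mathbb{Z}_+^{|V(G)|}$ is a vector of vertex capacities. A set $M\subseteq E(G)$ is a $c$-matching of $G$ if $|\{v: uv\in M\}|\le c_u$ for all $u\in V(G)$. Given a $c$-matching $M$, $d_u$ denotes the degree of $u$ in $M$, and $u$ is saturated in $M$ if $d_u=c_u$. $M$ is acyclic if the graph $(V(G),M)$ contains no cycle. A solution is a pair $(M,z)$ where $M$ is a $c$-matching of $G$ and $z\in\mathbb{R}_+^{2|E(G)|}$ assigns each edge $uv$ a pair of nonnegative values $z_{uv},z_{vu}$ such that $z_{uv}+z_{vu}=w_{uv}$ if $uv\in M$ and $z_{uv}=z_{vu}=0$ otherwise. The outside option of vertex $u$ with respect to $(M,z)$ is $$\alpha_u(M,z)=\max\Big(0,\ \max_{v:\,uv\in E(G)\setminus M}\big(w_{uv}-\mathbf{1}_{[d_v=c_v]}\min_{vw\in M}z_{vw}\big)\Big),$$ where $\mathbf{1}_{[\cdot]}$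 is the indicator of an event; $\alpha_u(M,z)=0$ if $\{v: uv\in E(G)\setminus M\}=\emptyset$. (The inner minimum is used only when $v$ is saturated; if $c_v=0$ it is a minimum over the empty set and is read as $+\infty$.) A solution $(M,z)$ is stable if $z_{uv}\ge\alpha_u(M,z)$ for every $uv\in M$ (for both endpoints of the edge), and $\alpha_u(M,z)=0$ for every unsaturated vertex $u$. It is balanced if it is stable and in addition $z_{uv}-\alpha_u(M,z)=z_{vu}-\alpha_v(M,z)$ for all $uv\in M$. The matching game associated with $(G,w,c)$ has player set $N=V(G)$ and value function $\nu(S)=\max\{w(M): M \text{ a } c\text{-matching of } G[S]\}$ for $S\subseteq N$, where $w(M)=\sum_{uv\in M}w_{uv}$ and $G[S]$ is the induced subgraph. For $x\in\mathbb{R}_+^{|N|}$ write $x(S)=\sum_{u\in S}x_u$, and for distinct $u,v\in N$ let $s_{uv}(x)=\max_{S\subseteq N:\,u\in S,\,v\notin S}\big(\nu(S)-x(S)\big)$. The core is $\mathcal{C}=\{x\in\mathbb{R}_+^{|N|}: x(S)\ge\nu(S)\ \forall S\subset N,\ x(N)=\nu(N)\}$ and the prekernel is $\mathcal{K}=\{x\in\mathbb{R}_+^{|N|}: s_{uv}(x)=s_{vu}(x)\ \forall\, u,v\in N,\ u\neq v\}$. Bad vertices. Let $(M,z)$ be a solution. For a vertex $u$ with $\alpha_u(M,z)>0$, let $v'$ be $u$'s best outside option, i.e. a vertex with $uv'\in E(G)\setminus M$ attaining the maximum defining $\alpha_u(M,z)$, and if $v'$ is saturated in $M$ let $u'$ be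 its weakest contract, i.e. a neighbour of $v'$ in $M$ minimizing $z_{v'u'}$; thus $\alpha_u(M,z)=w_{uv'}-\mathbf{1}_{[d_{v'}=c_{v'}]}z_{v'u'}$. (In case of ties, $v'$ and $u'$ are fixed choices for each $u$.) The vertex $u$ is bad in $(M,z)$ if, for some neighbour $v$ of $u$ in $M$, at least one of the following holds: (i) there is a $v$–$v'$ path in $M$ (a path all of whose edges lie in $M$); (ii) $v'$ is saturated and there is a $u$–$u'$ path in $M$ that does not pass through $v'$. *)

theory Defs
  imports Complex_Main "HOL-Library.Extended_Real"
begin

text \<open>
  An undirected edge between \<open>u\<close> and \<open>v\<close> is the two-element set \<open>{u, v}\<close>. A graph is given by
  its vertex set \<open>V\<close> and its edge set \<open>E\<close>; weights \<open>w\<close> are relevant on \<open>E\<close> only, and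
  capacities \<open>c\<close> on \<open>V\<close> only.
\<close>

definition bargaining_instance ::
    "'a set \<Rightarrow> 'a set set \<Rightarrow> ('a set \<Rightarrow> real) \<Rightarrow> ('a \<Rightarrow> nat) \<Rightarrow> bool" where
  "bargaining_instance V E w c \<longleftrightarrow>
     finite V \<and> (\<forall>e\<in>E. e \<subseteq> V \<and> card e = 2) \<and> (\<forall>e\<in>E. 0 \<le> w e)"

definition nbrs :: "'a set set \<Rightarrow> 'a \<Rightarrow> 'a set" where
  "nbrs F u = {v. {u, v} \<in> F}"

definition c_matching :: "'a set \<Rightarrow> 'a set set \<Rightarrow> ('a \<Rightarrow> nat) \<Rightarrow> 'a set set \<Rightarrow> bool" where
  "c_matching V E c M \<longleftrightarrow> M \<subseteq> E \<and> (\<forall>u\<in>V. card (nbrs M u) \<le> c u)"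

definition saturated :: "('a \<Rightarrow> nat) \<Rightarrow> 'a set set \<Rightarrow> 'a \<Rightarrow> bool" where
  "saturated c M u \<longleftrightarrow> card (nbrs M u) = c u"

definition path_between :: "'a set set \<Rightarrow> 'a \<Rightarrow> 'a list \<Rightarrow> 'a \<Rightarrow> bool" where
  "path_between F u p v \<longleftrightarrow>
     p \<noteq> [] \<and> hd p = u \<and> last p = v \<and> distinct p \<and> successively (\<lambda>a b. {a, b} \<in> F) p"

definition acyclic_edges :: "'a set set \<Rightarrow> bool" where
  "acyclic_edges F \<longleftrightarrow>
     (\<nexists>p. 3 \<le> length p \<and> path_between F (hd p) p (last p) \<and> {last p, hd p} \<in> F)"


text \<open>The number \<open>z u v\<close> is the share of \<open>u\<close> in the contract \<open>{u, v}\<close>.\<close>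

definition solution ::
    "'a set \<Rightarrow> 'a set set \<Rightarrow> ('a set \<Rightarrow> real) \<Rightarrow> ('a \<Rightarrow> nat) \<Rightarrow> 'a set set \<Rightarrow> ('a \<Rightarrow> 'a \<Rightarrow> real) \<Rightarrow> bool"
  where
  "solution V E w c M z \<longleftrightarrow>
     c_matching V E c M \<and>
     (\<forall>u v. {u, v} \<in> E \<longrightarrow> 0 \<le> z u v \<and>
        (if {u, v} \<in> M then z u v + z v u = w {u, v} else z u v = 0))"

text \<open>
  What \<open>v\<close> has to give up in order to contract with somebody new. The extended reals are used
  because the infimum over the empty set is then \<open>\<infinity>\<close>, which is the value wanted for a vertex
  of capacity \<open>0\<close>.
\<close>

definition switch_cost :: "('a \<Rightarrow> nat) \<Rightarrow> 'a set set \<Rightarrow> ('a \<Rightarrow> 'a \<Rightarrow> real) \<Rightarrow> 'a \<Rightarrow> ereal" where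
  "switch_cost c M z v = (if saturated c M v then (INF y\<in>nbrs M v. ereal (z v y)) else 0)"

definition offer ::
    "('a set \<Rightarrow> real) \<Rightarrow> ('a \<Rightarrow> nat) \<Rightarrow> 'a set set \<Rightarrow> ('a \<Rightarrow> 'a \<Rightarrow> real) \<Rightarrow> 'a \<Rightarrow> 'a \<Rightarrow> ereal" where
  "offer w c M z u v = ereal (w {u, v}) - switch_cost c M z v"

text \<open>Every offer is below \<open>\<infinity>\<close>, so the maximum with \<open>0\<close> is finite and the conversion to a real
  number loses nothing.\<close>

definition outside_option ::
    "'a set set \<Rightarrow> ('a set \<Rightarrow> real) \<Rightarrow> ('a \<Rightarrow> nat) \<Rightarrow> 'a set set \<Rightarrow> ('a \<Rightarrow> 'a \<Rightarrow> real) \<Rightarrow> 'a \<Rightarrow> real"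
  where
  "outside_option E w c M z u =
     real_of_ereal (Max (insert 0 (offer w c M z u ` nbrs (E - M) u)))"

definition stable_solution ::
    "'a set \<Rightarrow> 'a set set \<Rightarrow> ('a set \<Rightarrow> real) \<Rightarrow> ('a \<Rightarrow> nat) \<Rightarrow> 'a set set \<Rightarrow> ('a \<Rightarrow> 'a \<Rightarrow> real) \<Rightarrow> bool"
  where
  "stable_solution V E w c M z \<longleftrightarrow>
     solution V E w c M z \<and>
     (\<forall>u v. {u, v} \<in> M \<longrightarrow> outside_option E w c M z u \<le> z u v) \<and>
     (\<forall>u\<in>V. \<not> saturated c M u \<longrightarrow> outside_option E w c M z u = 0)"

definition balanced_solution ::
    "'a set \<Rightarrow> 'a set set \<Rightarrow> ('a set \<Rightarrow> real) \<Rightarrow> ('a \<Rightarrow> nat) \<Rightarrow> 'a set set \<Rightarrow> ('a \<Rightarrow> 'a \<Rightarrow> real) \<Rightarrow> bool"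
  where
  "balanced_solution V E w c M z \<longleftrightarrow>
     stable_solution V E w c M z \<and>
     (\<forall>u v. {u, v} \<in> M \<longrightarrow>
        z u v - outside_option E w c M z u = z v u - outside_option E w c M z v)"


definition game_value ::
    "'a set set \<Rightarrow> ('a set \<Rightarrow> real) \<Rightarrow> ('a \<Rightarrow> nat) \<Rightarrow> 'a set \<Rightarrow> real" where
  "game_value E w c S = Max {sum w M | M. c_matching S {e\<in>E. e \<subseteq> S} c M}"

definition core ::
    "'a set \<Rightarrow> 'a set set \<Rightarrow> ('a set \<Rightarrow> real) \<Rightarrow> ('a \<Rightarrow> nat) \<Rightarrow> ('a \<Rightarrow> real) set" where
  "core V E w c =
     {x. (\<forall>u\<in>V. 0 \<le> x u) \<and> (\<forall>S\<subseteq>V. game_value E w c S \<le> sum x S) \<and>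
         sum x V = game_value E w c V}"

definition surplus ::
    "'a set \<Rightarrow> 'a set set \<Rightarrow> ('a set \<Rightarrow> real) \<Rightarrow> ('a \<Rightarrow> nat) \<Rightarrow> ('a \<Rightarrow> real) \<Rightarrow> 'a \<Rightarrow> 'a \<Rightarrow> real" where
  "surplus V E w c x u v =
     Max {game_value E w c S - sum x S | S. S \<subseteq> V \<and> u \<in> S \<and> v \<notin> S}"

definition prekernel ::
    "'a set \<Rightarrow> 'a set set \<Rightarrow> ('a set \<Rightarrow> real) \<Rightarrow> ('a \<Rightarrow> nat) \<Rightarrow> ('a \<Rightarrow> real) set" where
  "prekernel V E w c =
     {x. (\<forall>u\<in>V. 0 \<le> x u) \<and>
         (\<forall>u\<in>V. \<forall>v\<in>V. u \<noteq> v \<longrightarrow> surplus V E w c x u v = surplus V E w c x v u)}"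


text \<open>
  The functions \<open>best\<close> and \<open>weak\<close> record, for each vertex \<open>u\<close> with a positive outside option,
  the chosen best outside option \<open>v'\<close> of \<open>u\<close> and the chosen weakest contract \<open>u'\<close> of \<open>v'\<close>;
  \<open>weak u\<close> is unconstrained if \<open>v'\<close> is not saturated.
\<close>

definition outside_choice ::
    "'a set \<Rightarrow> 'a set set \<Rightarrow> ('a set \<Rightarrow> real) \<Rightarrow> ('a \<Rightarrow> nat) \<Rightarrow> 'a set set \<Rightarrow> ('a \<Rightarrow> 'a \<Rightarrow> real) \<Rightarrow>
     ('a \<Rightarrow> 'a) \<Rightarrow> ('a \<Rightarrow> 'a) \<Rightarrow> bool" where
  "outside_choice V E w c M z best weak \<longleftrightarrow>
     (\<forall>u\<in>V. 0 < outside_option E w c M z u \<longrightarrow>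
        best u \<in> nbrs (E - M) u \<and>
        offer w c M z u (best u) = ereal (outside_option E w c M z u) \<and>
        (saturated c M (best u) \<longrightarrow>
           weak u \<in> nbrs M (best u) \<and>
           (\<forall>y\<in>nbrs M (best u). z (best u) (weak u) \<le> z (best u) y)))"

definition bad ::
    "'a set set \<Rightarrow> ('a set \<Rightarrow> real) \<Rightarrow> ('a \<Rightarrow> nat) \<Rightarrow> 'a set set \<Rightarrow> ('a \<Rightarrow> 'a \<Rightarrow> real) \<Rightarrow>
     ('a \<Rightarrow> 'a) \<Rightarrow> ('a \<Rightarrow> 'a) \<Rightarrow> 'a \<Rightarrow> bool" where
  "bad E w c M z best weak u \<longleftrightarrow>
     0 < outside_option E w c M z u \<and>
     (\<exists>v\<in>nbrs M u.
        (\<exists>p. path_between M v p (best u)) \<or>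
        (saturated c M (best u) \<and> (\<exists>p. path_between M u p (weak u) \<and> best u \<notin> set p)))"

end

theory Submission imports Defs begin

text \<open>
  For an edge \<open>ab\<close> of \<open>M\<close> one has \<open>s\<^sub>a\<^sub>b(x) = \<alpha>\<^sub>a - z\<^sub>a\<^sub>b\<close>. The upper bound holds for every stable
  solution: charge every edge of a competing matching on \<open>S\<close> to its ends, where a new edge costs
  its end \<open>y\<close> at most the weakest contract of \<open>y\<close>, and the vertex \<open>a\<close> at most \<open>\<alpha>\<^sub>a\<close>. The
  vertex \<open>a\<close> then keeps one contract less, namely the one with \<open>b\<close>. For the lower bound, cut \<open>ab\<close>, let \<open>a\<close>
  contract with its best outside option \<open>v'\<close>, and cut the weakest contract of \<open>v'\<close>; \<open>S\<close> consists
  of the two remaining components containing \<open>a\<close> and \<open>v'\<close>. This works because \<open>M\<close> is acyclic and,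
  \<open>a\<close> not being bad, \<open>v'\<close> lies in a different component of \<open>M\<close>.

  The set \<open>S\<close> separates all vertices of the component on the side of \<open>a\<close> from those on the side of
  \<open>b\<close>, so that for two vertices \<open>u\<close>, \<open>v\<close> of one component \<open>s\<^sub>u\<^sub>v(x)\<close> is the maximum of
  \<open>\<alpha>\<^sub>a - z\<^sub>a\<^sub>b\<close> over the edges \<open>ab\<close> of the path from \<open>u\<close> to \<open>v\<close>. For vertices of different
  components the surplus is \<open>0\<close>.
\<close>

section \<open>Connectedness\<close>

text \<open>As a relation, the edges make connectedness a reflexive transitive closure, which needs
  no simple paths and comes with induction.\<close>

definition adj :: "'a set set \<Rightarrow> ('a \<times> 'a) set" where
  "adj F = {(u, v). {u, v} \<in> F}"

definition comp_of :: "'a set set \<Rightarrow> 'a \<Rightarrow> 'a set" where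
  "comp_of F u = {v. (u, v) \<in> (adj F)\<^sup>*}"

lemma in_adj [simp]: "(u, v) \<in> adj F \<longleftrightarrow> {u, v} \<in> F"
  by (simp add: adj_def)

lemma adj_rtrancl_sym: "(u, v) \<in> (adj F)\<^sup>* \<Longrightarrow> (v, u) \<in> (adj F)\<^sup>*"
proof -
  have "sym (adj F)"
    by (auto simp: sym_def insert_commute)
  then show "(u, v) \<in> (adj F)\<^sup>* \<Longrightarrow> (v, u) \<in> (adj F)\<^sup>*"
    by (meson symD sym_rtrancl)
qed

lemma adj_rtrancl_mono: "F \<subseteq> F' \<Longrightarrow> (u, v) \<in> (adj F)\<^sup>* \<Longrightarrow> (u, v) \<in> (adj F')\<^sup>*"
  by (rule rtrancl_mono[THEN subsetD, of "adj F"]) auto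

lemma comp_of_self [simp]: "u \<in> comp_of F u"
  by (simp add: comp_of_def)

lemma comp_of_step: "v \<in> comp_of F u \<Longrightarrow> {v, y} \<in> F \<Longrightarrow> y \<in> comp_of F u"
  by (auto simp: comp_of_def intro: rtrancl_into_rtrancl)

lemma comp_of_subset:
  assumes "u \<in> V" and "\<And>e. e \<in> F \<Longrightarrow> e \<subseteq> V"
  shows "comp_of F u \<subseteq> V"
proof
  fix v assume "v \<in> comp_of F u"
  then have "(u, v) \<in> (adj F)\<^sup>*" by (simp add: comp_of_def)
  then show "v \<in> V"
    by (induction) (use assms in auto)
qed

lemma path_between_imp_rtrancl:
  "path_between F u p v \<Longrightarrow> (u, v) \<in> (adj F)\<^sup>*"
proof (induction p arbitrary: u)
  case Nil
  then show ?case by (simp add: path_between_def)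
next
  case (Cons y p)
  show ?case
  proof (cases p)
    case Nil
    with Cons.prems show ?thesis by (auto simp: path_between_def)
  next
    case (Cons q ps)
    then have "path_between F q p v" "{u, q} \<in> F"
      using Cons.prems by (auto simp: path_between_def)
    with Cons.IH show ?thesis
      by (meson converse_rtrancl_into_rtrancl in_adj)
  qed
qed

lemma rtrancl_imp_path_between:
  "(u, v) \<in> (adj F)\<^sup>* \<Longrightarrow> \<exists>p. path_between F u p v"
proof (induction rule: converse_rtrancl_induct)
  case base
  have "path_between F v [v] v" by (simp add: path_between_def)
  then show ?case by blast
next
  case (step u y)
  then obtain p where p: "path_between F y p v" by blast
  show ?case
  proof (cases "u \<in> set p")
    case True
    \<comment> \<open>Prepending \<open>u\<close> would repeat a vertex; the part of
      \<open>p\<close> from \<open>u\<close> on already is a path.\<close>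
    then obtain xs ys where "p = xs @ u # ys" by (meson split_list)
    with p have "path_between F u (u # ys) v"
      by (auto simp: path_between_def successively_append_iff)
    then show ?thesis by blast
  next
    case False
    with p step.hyps have "path_between F u (u # p) v"
      by (cases p) (auto simp: path_between_def)
    then show ?thesis by blast
  qed
qed

text \<open>A detour from \<open>a\<close> to \<open>b\<close> would close to a cycle with the edge.
  It has at least three vertices: one would give \<open>a = b\<close>, and two would use the removed
  edge.\<close>

lemma acyclic_edges_bridge:
  assumes "acyclic_edges M" and "{a, b} \<in> M" and "a \<noteq> b"
  shows "(a, b) \<notin> (adj (M - {{a, b}}))\<^sup>*"
proof
  assume "(a, b) \<in> (adj (M - {{a, b}}))\<^sup>*"
  from rtrancl_imp_path_between[OF this]
  obtain p where p: "path_between (M - {{a, b}}) a p b" ..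
  have "3 \<le> length p"
  proof (rule ccontr)
    assume "\<not> 3 \<le> length p"
    then consider "p = []" | y where "p = [y]" | y y' where "p = [y, y']"
      by (cases p; cases "tl p"; cases "tl (tl p)") auto
    then show False
      by cases (use p assms in \<open>auto simp: path_between_def\<close>)
  qed
  moreover have "path_between M (hd p) p (last p)"
    using p by (auto simp: path_between_def elim: successively_mono)
  moreover have "{last p, hd p} \<in> M"
    using p assms(2) by (auto simp: path_between_def insert_commute)
  ultimately show False
    using assms(1) unfolding acyclic_edges_def by blast
qed

lemma list_exit_split:
  assumes "p \<noteq> []" and "hd p \<in> S" and "last p \<notin> S"
  shows "\<exists>xs a b ys. p = xs @ a # b # ys \<and> a \<in> S \<and> b \<notin> S"
  using assms
proof (induction p)
  case Nil
  then show ?case by simp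
next
  case (Cons u p)
  then have ne: "p \<noteq> []" by auto
  show ?case
  proof (cases "hd p \<in> S")
    case True
    with Cons ne obtain xs a b ys where "p = xs @ a # b # ys" "a \<in> S" "b \<notin> S"
      by auto
    then have "u # p = (u # xs) @ a # b # ys" "a \<in> S" "b \<notin> S"
      by auto
    then show ?thesis by blast
  next
    case False
    with Cons ne have "u # p = [] @ u # hd p # tl p" "u \<in> S" "hd p \<notin> S"
      by auto
    then show ?thesis by blast
  qed
qed

text \<open>A simple path from \<open>u\<close> to \<open>v\<close> leaves \<open>S\<close> along
  some \<open>ab\<close>. It visits \<open>a\<close> and \<open>b\<close> only once, so its pieces
  before and after the crossing avoid that edge.\<close>

lemma exit_edge:
  assumes "(u, v) \<in> (adj M)\<^sup>*" and "u \<in> S" and "v \<notin> S"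
  shows "\<exists>a b. {a, b} \<in> M \<and> a \<in> S \<and> b \<notin> S \<and>
    (a, u) \<in> (adj (M - {{a, b}}))\<^sup>* \<and> (b, v) \<in> (adj (M - {{a, b}}))\<^sup>*"
proof -
  obtain p where p: "path_between M u p v"
    using rtrancl_imp_path_between[OF assms(1)] by blast
  then obtain xs a b ys where eq: "p = xs @ a # b # ys" and ab: "a \<in> S" "b \<notin> S"
    using list_exit_split[of p S] assms by (auto simp: path_between_def)
  have succ: "successively (\<lambda>a b. {a, b} \<in> M) (xs @ [a])"
      "successively (\<lambda>a b. {a, b} \<in> M) (b # ys)" and edge: "{a, b} \<in> M"
    using p unfolding eq by (auto simp: path_between_def successively_append_iff)
  have dist: "distinct (xs @ [a])" "distinct (b # ys)" "b \<notin> set (xs @ [a])" "a \<notin> set (b # ys)"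
    using p unfolding eq path_between_def by auto
  have ends: "hd (xs @ [a]) = u" "last (b # ys) = v"
    using p unfolding eq path_between_def by (auto simp: hd_append split: if_splits)
  have "successively (\<lambda>c d. {c, d} \<in> M - {{a, b}}) (xs @ [a])"
    by (rule successively_mono[OF succ(1)]) (use dist in \<open>auto simp: doubleton_eq_iff\<close>)
  then have "path_between (M - {{a, b}}) u (xs @ [a]) a"
    using ends dist by (simp add: path_between_def)
  moreover have "successively (\<lambda>c d. {c, d} \<in> M - {{a, b}}) (b # ys)"
    by (rule successively_mono[OF succ(2)]) (use dist in \<open>auto simp: doubleton_eq_iff\<close>)
  then have "path_between (M - {{a, b}}) b (b # ys) v"
    using ends dist by (simp add: path_between_def)
  ultimately show ?thesis
    using edge ab path_between_imp_rtrancl adj_rtrancl_sym by metis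
qed

section \<open>Summation over edges\<close>

text \<open>Grouped by edges, the ordered pairs of adjacent vertices fall into classes of exactly
  two, one pair for each orientation.\<close>

lemma sum_edges_double_count:
  fixes g :: "'a \<Rightarrow> 'a \<Rightarrow> real"
  assumes "finite S" and N: "\<And>e. e \<in> N \<Longrightarrow> e \<subseteq> S \<and> card e = 2"
    and k: "\<And>u v. {u, v} \<in> N \<Longrightarrow> k {u, v} = g u v + g v u"
  shows "(\<Sum>e\<in>N. k e) = (\<Sum>u\<in>S. \<Sum>v\<in>nbrs N u. g u v)"
proof -
  let ?P = "SIGMA u:S. nbrs N u"
  have sub: "nbrs N u \<subseteq> S" for u
    using N by (auto simp: nbrs_def)
  then have fin: "finite (nbrs N u)" for u
    using \<open>finite S\<close> finite_subset by blast
  have "finite N"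
    by (rule finite_subset[of _ "Pow S"]) (use N \<open>finite S\<close> in auto)
  have "(\<Sum>u\<in>S. \<Sum>v\<in>nbrs N u. g u v) = (\<Sum>(u, v)\<in>?P. g u v)"
    using \<open>finite S\<close> fin by (simp add: sum.Sigma)
  also have "\<dots> = (\<Sum>e\<in>N. \<Sum>q\<in>{q \<in> ?P. (\<lambda>(u, v). {u, v}) q = e}. (\<lambda>(u, v). g u v) q)"
    by (rule sum.group[symmetric]) (use \<open>finite S\<close> fin \<open>finite N\<close> in \<open>auto simp: nbrs_def\<close>)
  also have "\<dots> = (\<Sum>e\<in>N. k e)"
  proof (rule sum.cong[OF refl])
    fix e assume e: "e \<in> N"
    with N obtain u v where uv: "e = {u, v}" "u \<noteq> v"
      by (meson card_2_iff)
    have "{q \<in> ?P. (\<lambda>(u, v). {u, v}) q = e} = {(u, v), (v, u)}"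
      using N[OF e] e uv by (auto simp: nbrs_def doubleton_eq_iff insert_commute)
    then show "(\<Sum>q\<in>{q \<in> ?P. (\<lambda>(u, v). {u, v}) q = e}. (\<lambda>(u, v). g u v) q) = k e"
      using uv e k by simp
  qed
  finally show ?thesis by simp
qed

text \<open>The exchange at one vertex: \<open>B\<close> are its old partners, \<open>A\<close> the
  new ones, \<open>h\<close> is the price of a new contract. Either new contracts cost nothing, or
  the partners gained are no more than those given up, each worth at least \<open>h\<close>.\<close>

lemma sum_exchange_le:
  fixes f :: "'a \<Rightarrow> real"
  assumes "finite A" "finite B" and "0 \<le> h" and "\<And>y. y \<in> B \<Longrightarrow> h \<le> f y"
    and "h = 0 \<or> card A \<le> card B"
  shows "(\<Sum>y\<in>A. if y \<in> B then f y else h) \<le> sum f B"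
proof -
  have "card A = card (A \<inter> B) + card (A - B)" "card B = card (A \<inter> B) + card (B - A)"
    using assms(1,2) card_Int_Diff[of A B] card_Int_Diff[of B A] by (auto simp: Int_commute)
  with assms(5) have "h = 0 \<or> card (A - B) \<le> card (B - A)" by linarith
  then have c: "real (card (A - B)) * h \<le> real (card (B - A)) * h"
    using \<open>0 \<le> h\<close> by (auto intro: mult_right_mono)
  have "(\<Sum>y\<in>A. if y \<in> B then f y else h) = (\<Sum>y\<in>A \<inter> B. f y) + (\<Sum>y\<in>A - B. h)"
    unfolding sum.Int_Diff[OF assms(1), of "\<lambda>y. if y \<in> B then f y else h" B]
    by (intro arg_cong2[where f = "(+)"] sum.cong) auto
  also have "\<dots> \<le> (\<Sum>y\<in>A \<inter> B. f y) + (\<Sum>y\<in>B - A. h)"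
    using c by simp
  also have "\<dots> \<le> (\<Sum>y\<in>A \<inter> B. f y) + (\<Sum>y\<in>B - A. f y)"
    using assms(4) by (intro add_left_mono sum_mono) auto
  also have "\<dots> = sum f B"
    using sum.Int_Diff[OF assms(2), of f A] by (simp add: Int_commute)
  finally show ?thesis .
qed

text \<open>As \<open>b\<close> is not in \<open>A\<close>, the left side does not see
  \<open>f b\<close>; the exchange still works after lowering this value to
  \<open>h\<close>.\<close>

lemma sum_exchange_le_drop:
  fixes f :: "'a \<Rightarrow> real"
  assumes "finite A" "finite B" and "0 \<le> h" and "\<And>y. y \<in> B \<Longrightarrow> h \<le> f y"
    and "h = 0 \<or> card A \<le> card B" and "b \<in> B" "b \<notin> A"
  shows "(\<Sum>y\<in>A. if y \<in> B then f y else h) \<le> sum f B - f b + h"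
proof -
  let ?f = "f(b := h)"
  have "(\<Sum>y\<in>A. if y \<in> B then f y else h) = (\<Sum>y\<in>A. if y \<in> B then ?f y else h)"
    using assms(7) by (intro sum.cong) auto
  also have "\<dots> \<le> sum ?f B"
    by (rule sum_exchange_le) (use assms in auto)
  also have "\<dots> = h + sum f (B - {b})"
    using assms(2,6) by (subst sum.remove[of _ b]) (auto intro: sum.cong)
  also have "\<dots> = sum f B - f b + h"
    using assms(2,6) by (simp add: sum.remove[of _ b])
  finally show ?thesis .
qed

section \<open>Stable solutions and their allocations\<close>

locale stable_allocation =
  fixes V :: "'a set" and E :: "'a set set" and w :: "'a set \<Rightarrow> real" and c :: "'a \<Rightarrow> nat"
    and M :: "'a set set" and z :: "'a \<Rightarrow> 'a \<Rightarrow> real" and x :: "'a \<Rightarrow> real"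
  assumes inst: "bargaining_instance V E w c"
    and stable: "stable_solution V E w c M z"
    and alloc: "\<forall>u\<in>V. x u = (\<Sum>v\<in>nbrs M u. z u v)"
begin

abbreviation \<alpha> :: "'a \<Rightarrow> real" where
  "\<alpha> \<equiv> outside_option E w c M z"

abbreviation \<nu> :: "'a set \<Rightarrow> real" where
  "\<nu> \<equiv> game_value E w c"

lemma finV: "finite V"
  using inst by (simp add: bargaining_instance_def)

lemma edgeE: "e \<in> E \<Longrightarrow> e \<subseteq> V \<and> card e = 2"
  using inst by (simp add: bargaining_instance_def)

lemma edge_neq: "{u, v} \<in> E \<Longrightarrow> u \<noteq> v"
  using edgeE[of "{u, v}"] by auto

lemma finE: "finite E"
  by (rule finite_subset[of _ "Pow V"]) (use edgeE finV in auto)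

lemma ME: "M \<subseteq> E"
  using stable by (simp add: stable_solution_def solution_def c_matching_def)

lemma card_nbrs_le: "u \<in> V \<Longrightarrow> card (nbrs M u) \<le> c u"
  using stable by (simp add: stable_solution_def solution_def c_matching_def)

lemma nbrs_subset: "F \<subseteq> E \<Longrightarrow> nbrs F u \<subseteq> V"
  using edgeE by (fastforce simp: nbrs_def)

lemma finite_nbrs: "F \<subseteq> E \<Longrightarrow> finite (nbrs F u)"
  using nbrs_subset finV finite_subset by metis

lemma z_nonneg: "{u, v} \<in> E \<Longrightarrow> 0 \<le> z u v"
  using stable by (simp add: stable_solution_def solution_def)

lemma z_sum: "{u, v} \<in> M \<Longrightarrow> z u v + z v u = w {u, v}"
  using stable ME unfolding stable_solution_def solution_def by (metis subsetD)

lemma outside_option_le: "{u, v} \<in> M \<Longrightarrow> \<alpha> u \<le> z u v"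
  using stable by (simp add: stable_solution_def)

lemma outside_option_unsaturated: "u \<in> V \<Longrightarrow> \<not> saturated c M u \<Longrightarrow> \<alpha> u = 0"
  using stable by (simp add: stable_solution_def)

lemma switch_cost_nonneg: "0 \<le> switch_cost c M z y"
proof -
  have "0 \<le> z y q" if "q \<in> nbrs M y" for q
    using that z_nonneg[of y q] ME by (auto simp: nbrs_def)
  then show ?thesis
    by (auto simp: switch_cost_def intro!: INF_greatest)
qed

lemma ereal_outside_option:
  "ereal (\<alpha> u) = Max (insert 0 (offer w c M z u ` nbrs (E - M) u))"
proof -
  let ?X = "insert 0 (offer w c M z u ` nbrs (E - M) u)"
  have fin: "finite ?X"
    using finite_nbrs[of "E - M" u] by auto
  \<comment> \<open>An offer can be \<open>-\<infinity>\<close>, but not \<open>\<infinity>\<close>,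
    since no switching cost is negative; the inserted 0 bounds the maximum from below.\<close>
  have "offer w c M z u y < \<infinity>" for y
    using switch_cost_nonneg[of y] unfolding offer_def
    by (cases "switch_cost c M z y") auto
  then have "Max ?X < \<infinity>"
    using fin by (subst Max_less_iff) auto
  moreover have "0 \<le> Max ?X"
    using fin by (intro Max_ge) auto
  ultimately have "\<bar>Max ?X\<bar> \<noteq> \<infinity>" by auto
  then show ?thesis
    unfolding outside_option_def by (simp add: ereal_real)
qed

lemma outside_option_nonneg: "0 \<le> \<alpha> u"
proof -
  have "0 \<le> ereal (\<alpha> u)"
    unfolding ereal_outside_option
    using finite_nbrs[of "E - M" u] by (intro Max_ge) auto
  then show ?thesis by simp
qed

lemma offer_le:
  assumes "{u, y} \<in> E - M"
  shows "offer w c M z u y \<le> ereal (\<alpha> u)"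
  unfolding ereal_outside_option
  using finite_nbrs[of "E - M" u] assms by (intro Max_ge) (auto simp: nbrs_def)

text \<open>Positive capacity keeps the infimum off the empty set. A saturated vertex pays its
  weakest contract, an unsaturated one nothing; stability gives \<open>\<alpha> y \<le> t\<close> in
  both cases.\<close>

lemma switch_cost_real:
  assumes "y \<in> V" and "0 < c y"
  obtains t where "switch_cost c M z y = ereal t" "\<alpha> y \<le> t" "0 \<le> t"
    "saturated c M y \<Longrightarrow> (\<And>q. {y, q} \<in> M \<Longrightarrow> t \<le> z y q)" "\<not> saturated c M y \<Longrightarrow> t = 0"
proof (cases "saturated c M y")
  case True
  then have ne: "nbrs M y \<noteq> {}" and fin: "finite (nbrs M y)"
    using assms finite_nbrs[OF ME] by (auto simp: saturated_def)
  then have "Min (z y ` nbrs M y) \<in> z y ` nbrs M y"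
    by (intro Min_in) auto
  then obtain q where q: "q \<in> nbrs M y" "z y q = Min (z y ` nbrs M y)"
    by (metis imageE)
  have le: "z y q \<le> z y q'" if "q' \<in> nbrs M y" for q'
    using q fin that by simp
  have "switch_cost c M z y = ereal (z y q)"
    unfolding switch_cost_def using True q le
    by (auto intro!: antisym INF_lower2[of q] INF_greatest)
  moreover have "{y, q} \<in> M" using q by (simp add: nbrs_def)
  ultimately show thesis
    using that[of "z y q"] le outside_option_le z_nonneg ME True
    by (metis mem_Collect_eq nbrs_def subsetD)
next
  case False
  then show thesis
    using that[of 0] outside_option_unsaturated[OF assms(1)]
    by (simp add: switch_cost_def zero_ereal_def)
qed

subsection \<open>The value function and the surplus\<close>

lemma game_value_finite: "finite {sum w N | N. c_matching S {e \<in> E. e \<subseteq> S} c N}"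
proof -
  have "{sum w N | N. c_matching S {e \<in> E. e \<subseteq> S} c N} \<subseteq> sum w ` Pow E"
    by (auto simp: c_matching_def)
  then show ?thesis
    using finE finite_subset by blast
qed

lemma game_value_ge: "c_matching S {e \<in> E. e \<subseteq> S} c N \<Longrightarrow> sum w N \<le> \<nu> S"
  unfolding game_value_def using game_value_finite by (intro Max_ge) auto

lemma game_value_attained:
  obtains N where "c_matching S {e \<in> E. e \<subseteq> S} c N" "\<nu> S = sum w N"
proof -
  have "c_matching S {e \<in> E. e \<subseteq> S} c {}"
    by (simp add: c_matching_def nbrs_def)
  then have "\<nu> S \<in> {sum w N | N. c_matching S {e \<in> E. e \<subseteq> S} c N}"
    unfolding game_value_def using game_value_finite by (intro Max_in) auto
  then show thesis using that by blast
qed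

lemma surplus_finite: "finite {\<nu> S - sum x S | S. S \<subseteq> V \<and> u \<in> S \<and> v \<notin> S}"
proof -
  have "{\<nu> S - sum x S | S. S \<subseteq> V \<and> u \<in> S \<and> v \<notin> S} \<subseteq> (\<lambda>S. \<nu> S - sum x S) ` Pow V"
    by auto
  then show ?thesis
    using finV finite_subset by blast
qed

lemma surplus_ge:
  "S \<subseteq> V \<Longrightarrow> u \<in> S \<Longrightarrow> v \<notin> S \<Longrightarrow> \<nu> S - sum x S \<le> surplus V E w c x u v"
  unfolding surplus_def using surplus_finite by (intro Max_ge) auto

lemma surplus_le:
  assumes "u \<in> V" "u \<noteq> v"
    and "\<And>S. S \<subseteq> V \<Longrightarrow> u \<in> S \<Longrightarrow> v \<notin> S \<Longrightarrow> \<nu> S - sum x S \<le> t"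
  shows "surplus V E w c x u v \<le> t"
proof -
  have "{\<nu> S - sum x S | S. S \<subseteq> V \<and> u \<in> S \<and> v \<notin> S} \<noteq> {}"
    using assms(1,2) by (auto intro!: exI[of _ "{u}"])
  then show ?thesis
    unfolding surplus_def using surplus_finite assms(3) by (subst Max_le_iff) auto
qed

subsection \<open>Upper bound for the surplus\<close>

lemma excess_le:
  assumes ab: "{a, b} \<in> M" and S: "S \<subseteq> V" "a \<in> S" "b \<notin> S"
  shows "\<nu> S - sum x S \<le> \<alpha> a - z a b"
proof -
  obtain N where N: "c_matching S {e \<in> E. e \<subseteq> S} c N" and val: "\<nu> S = sum w N"
    using game_value_attained .
  have NE: "N \<subseteq> E" and NS: "\<And>e. e \<in> N \<Longrightarrow> e \<subseteq> S"
    and Ncard: "\<And>u. u \<in> S \<Longrightarrow> card (nbrs N u) \<le> c u"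
    using N by (auto simp: c_matching_def)
  have finS: "finite S"
    using S finV finite_subset by blast
  have posc: "0 < c u" if "{u, y} \<in> N" for u y
  proof -
    have "u \<in> S" using NS[OF that] by simp
    moreover have "nbrs N u \<noteq> {}" using that by (auto simp: nbrs_def)
    ultimately show ?thesis
      using Ncard[of u] finite_nbrs[OF NE, of u] by (cases "c u") auto
  qed
  have "\<forall>y. \<exists>t. y \<in> V \<longrightarrow> 0 < c y \<longrightarrow> switch_cost c M z y = ereal t \<and> \<alpha> y \<le> t \<and> 0 \<le> t \<and>
      (saturated c M y \<longrightarrow> (\<forall>q. {y, q} \<in> M \<longrightarrow> t \<le> z y q)) \<and> (\<not> saturated c M y \<longrightarrow> t = 0)"
    by (metis switch_cost_real)
  then obtain t where t: "\<And>y. y \<in> V \<Longrightarrow> 0 < c y \<Longrightarrow> switch_cost c M z y = ereal (t y) \<and>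
      \<alpha> y \<le> t y \<and> 0 \<le> t y \<and> (saturated c M y \<longrightarrow> (\<forall>q. {y, q} \<in> M \<longrightarrow> t y \<le> z y q)) \<and>
      (\<not> saturated c M y \<longrightarrow> t y = 0)"
    by metis
  \<comment> \<open>The price of a new edge at each end: the switching cost, except that
    \<open>a\<close> pays only its outside option.\<close>
  define h where "h = t(a := \<alpha> a)"
  define g where "g = (\<lambda>u y. if y \<in> nbrs M u then z u y else h u)"
  have new: "w {u, y} \<le> h u + h y" if uy: "{u, y} \<in> N" "{u, y} \<notin> M" for u y
  proof -
    have V: "u \<in> V" "y \<in> V" using uy NS S by auto
    have c: "0 < c u" "0 < c y"
      using posc[of u y] posc[of y u] uy(1) by (simp_all add: insert_commute)
    have E: "{u, y} \<in> E - M" "{y, u} \<in> E - M" "u \<noteq> y"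
      using uy NE edge_neq[of u y] by (auto simp: insert_commute)
    \<comment> \<open>The edge is an offer in both directions. At most one end is \<open>a\<close>,
      and \<open>\<alpha>\<close> is below \<open>t\<close>, so one of the two bounds yields
      \<open>h u + h y\<close>.\<close>
    have "w {u, y} \<le> \<alpha> u + t y" "w {u, y} \<le> \<alpha> y + t u"
      using offer_le[OF E(1)] offer_le[OF E(2)] t[OF V(1) c(1)] t[OF V(2) c(2)]
      by (auto simp: offer_def insert_commute)
    then show ?thesis
      using t[OF V(1) c(1)] t[OF V(2) c(2)] E(3) by (auto simp: h_def)
  qed
  \<comment> \<open>The hypotheses of the exchange. A saturated vertex has at least as many
    contracts in \<open>M\<close> as in \<open>N\<close>; at an unsaturated one, even at
    \<open>a\<close>, the price is 0.\<close>
  have h: "0 \<le> h u \<and> (\<forall>y\<in>nbrs M u. h u \<le> z u y) \<and> (h u = 0 \<or> card (nbrs N u) \<le> card (nbrs M u))"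
    if u: "u \<in> S" "0 < c u" for u
  proof -
    have V: "u \<in> V" using u S by auto
    have zn: "0 \<le> z u y" if "{u, y} \<in> M" for y
      using that z_nonneg ME by auto
    show ?thesis
      using t[OF V u(2)] Ncard[OF u(1)] outside_option_le[of u] outside_option_nonneg[of u] zn
        outside_option_unsaturated[OF V]
      by (auto simp: h_def nbrs_def saturated_def)
  qed
  have vertex: "(\<Sum>y\<in>nbrs N u. g u y) \<le> x u" if u: "u \<in> S" for u
  proof (cases "c u = 0")
    case True
    then have "nbrs N u = {}"
      using Ncard[OF u] finite_nbrs[OF NE] by simp
    moreover have "nbrs M u = {}"
      using True card_nbrs_le[of u] finite_nbrs[OF ME] u S by auto
    ultimately show ?thesis
      using alloc u S by auto
  next
    case False
    then have "(\<Sum>y\<in>nbrs N u. g u y) \<le> (\<Sum>y\<in>nbrs M u. z u y)"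
      unfolding g_def
      by (intro sum_exchange_le) (use h[OF u] finite_nbrs NE ME in auto)
    then show ?thesis
      using alloc u S by auto
  qed
  have "0 < c a"
  proof -
    have "nbrs M a \<noteq> {}" using ab by (auto simp: nbrs_def)
    then show ?thesis
      using card_nbrs_le[of a] S finite_nbrs[OF ME, of a] by (cases "c a") auto
  qed
  moreover have "b \<in> nbrs M a" using ab by (simp add: nbrs_def)
  \<comment> \<open>\<open>N\<close> stays inside \<open>S\<close>, so \<open>a\<close> gives up its
    contract with \<open>b\<close>; this produces the term \<open>- z a b\<close>.\<close>
  moreover have "b \<notin> nbrs N a" using NS S by (auto simp: nbrs_def)
  ultimately have "(\<Sum>y\<in>nbrs N a. g a y) \<le> (\<Sum>y\<in>nbrs M a. z a y) - z a b + h a"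
    unfolding g_def
    by (intro sum_exchange_le_drop) (use h[OF S(2)] finite_nbrs NE ME in auto)
  then have at_a: "(\<Sum>y\<in>nbrs N a. g a y) \<le> x a - z a b + \<alpha> a"
    using alloc S by (auto simp: h_def)
  \<comment> \<open>\<open>g\<close> depends on the orientation, but \<open>N\<close> consists of
    unordered edges; \<open>k\<close> collects both orientations.\<close>
  define k where "k = (\<lambda>e. \<Sum>u\<in>e. \<Sum>y\<in>e - {u}. g u y)"
  have k: "k {u, y} = g u y + g y u" if "u \<noteq> y" for u y
    using that by (simp add: k_def insert_Diff_if)
  have "sum w N \<le> (\<Sum>e\<in>N. k e)"
  proof (rule sum_mono)
    fix e assume e: "e \<in> N"
    then obtain u y where uy: "e = {u, y}" "u \<noteq> y"
      using NE edgeE by (meson card_2_iff subsetD)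
    show "w e \<le> k e"
    proof (cases "e \<in> M")
      case True
      then show ?thesis
        using z_sum[of u y] uy k[OF uy(2)] by (simp add: g_def nbrs_def insert_commute)
    next
      case False
      then show ?thesis
        using new[of u y] e uy k[OF uy(2)] by (simp add: g_def nbrs_def insert_commute)
    qed
  qed
  also have "\<dots> = (\<Sum>u\<in>S. \<Sum>y\<in>nbrs N u. g u y)"
  proof (rule sum_edges_double_count[OF finS])
    show "e \<subseteq> S \<and> card e = 2" if "e \<in> N" for e
      using that NS NE edgeE by blast
    show "k {u, y} = g u y + g y u" if "{u, y} \<in> N" for u y
      using that NE edge_neq by (intro k) blast
  qed
  also have "\<dots> = (\<Sum>y\<in>nbrs N a. g a y) + (\<Sum>u\<in>S - {a}. \<Sum>y\<in>nbrs N u. g u y)"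
    using finS S by (simp add: sum.remove)
  also have "\<dots> \<le> x a - z a b + \<alpha> a + (\<Sum>u\<in>S - {a}. x u)"
    using at_a vertex by (intro add_mono sum_mono) auto
  also have "\<dots> = sum x S - z a b + \<alpha> a"
    using finS S by (simp add: sum.remove[of S a])
  finally show ?thesis
    using val by simp
qed

subsection \<open>Lower bounds for the surplus\<close>

text \<open>The contracts broken by retreating to \<open>S\<close>. The inner end comes first, as
  only its share counts in \<open>sum x S\<close>.\<close>

definition cut_pairs :: "'a set \<Rightarrow> ('a \<times> 'a) set" where
  "cut_pairs S = {(u, y). u \<in> S \<and> y \<notin> S \<and> {u, y} \<in> M}"

text \<open>A contract inside \<open>S\<close> contributes both shares, hence its weight; a broken
  one contributes only the share of its inner end.\<close>

lemma sum_alloc: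
  assumes "S \<subseteq> V"
  shows "sum x S = sum w {e \<in> M. e \<subseteq> S} + (\<Sum>(u, y)\<in>cut_pairs S. z u y)"
proof -
  let ?N = "{e \<in> M. e \<subseteq> S}"
  have finS: "finite S"
    using assms finV finite_subset by blast
  have inner: "sum w ?N = (\<Sum>u\<in>S. \<Sum>y\<in>nbrs ?N u. z u y)"
    by (rule sum_edges_double_count[OF finS]) (use ME edgeE z_sum in auto)
  have "(\<Sum>(u, y)\<in>cut_pairs S. z u y) = (\<Sum>u\<in>S. \<Sum>y\<in>nbrs M u - S. z u y)"
  proof -
    have "cut_pairs S = (SIGMA u:S. nbrs M u - S)"
      by (auto simp: cut_pairs_def nbrs_def)
    then show ?thesis
      using finS finite_nbrs[OF ME] by (simp add: sum.Sigma)
  qed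
  moreover have "x u = (\<Sum>y\<in>nbrs ?N u. z u y) + (\<Sum>y\<in>nbrs M u - S. z u y)" if "u \<in> S" for u
  proof -
    have "nbrs ?N u = nbrs M u \<inter> S"
      using that by (auto simp: nbrs_def)
    then show ?thesis
      using alloc that assms sum.Int_Diff[OF finite_nbrs[OF ME, of u], of "z u" S] by auto
  qed
  ultimately show ?thesis
    using inner by (simp add: sum.distrib)
qed

text \<open>The contracts of \<open>M\<close> inside \<open>S\<close> are a feasible matching, so
  \<open>S\<close> loses at most its shares in broken contracts.\<close>

lemma excess_ge:
  assumes "S \<subseteq> V"
  shows "- (\<Sum>(u, y)\<in>cut_pairs S. z u y) \<le> \<nu> S - sum x S"
proof -
  let ?N = "{e \<in> M. e \<subseteq> S}"
  have "card (nbrs ?N u) \<le> c u" if "u \<in> S" for u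
  proof -
    have "card (nbrs ?N u) \<le> card (nbrs M u)"
      by (intro card_mono finite_nbrs[OF ME]) (auto simp: nbrs_def)
    then show ?thesis
      using card_nbrs_le[of u] that assms by auto
  qed
  then have "c_matching S {e \<in> E. e \<subseteq> S} c ?N"
    using ME by (auto simp: c_matching_def)
  from game_value_ge[OF this] sum_alloc[OF assms] show ?thesis
    by simp
qed

text \<open>Inside \<open>S\<close> both \<open>p\<close> and \<open>q\<close> have room for one
  more contract, so \<open>pq\<close> can be added to the part of \<open>M\<close> inside
  \<open>S\<close>.\<close>

lemma excess_ge_new_edge:
  assumes S: "S \<subseteq> V" and pq: "{p, q} \<in> E - M" "p \<in> S" "q \<in> S"
    and p: "card (nbrs M p \<inter> S) < c p" and q: "card (nbrs M q \<inter> S) < c q"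
  shows "w {p, q} - (\<Sum>(u, y)\<in>cut_pairs S. z u y) \<le> \<nu> S - sum x S"
proof -
  let ?N = "{e \<in> M. e \<subseteq> S}"
  let ?N' = "insert {p, q} ?N"
  have "p \<noteq> q" using pq edge_neq by auto
  have "card (nbrs ?N' u) \<le> c u" if "u \<in> S" for u
  proof -
    have "u = p \<or> u = q \<or> u \<noteq> p \<and> u \<noteq> q" by auto
    then show ?thesis
    proof (elim disjE conjE)
      assume "u = p"
      then have "nbrs ?N' u \<subseteq> insert q (nbrs M p \<inter> S)"
        by (auto simp: nbrs_def doubleton_eq_iff)
      then have "card (nbrs ?N' u) \<le> card (insert q (nbrs M p \<inter> S))"
        by (intro card_mono) (auto intro: finite_nbrs[OF ME])
      then show ?thesis
        using p \<open>u = p\<close> finite_nbrs[OF ME, of p] by (auto simp: card_insert_if split: if_splits)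
    next
      assume "u = q"
      then have "nbrs ?N' u \<subseteq> insert p (nbrs M q \<inter> S)"
        by (auto simp: nbrs_def doubleton_eq_iff)
      then have "card (nbrs ?N' u) \<le> card (insert p (nbrs M q \<inter> S))"
        by (intro card_mono) (auto intro: finite_nbrs[OF ME])
      then show ?thesis
        using q \<open>u = q\<close> finite_nbrs[OF ME, of q] by (auto simp: card_insert_if split: if_splits)
    next
      assume "u \<noteq> p" "u \<noteq> q"
      then have "nbrs ?N' u \<subseteq> nbrs M u"
        by (auto simp: nbrs_def doubleton_eq_iff)
      then have "card (nbrs ?N' u) \<le> card (nbrs M u)"
        by (intro card_mono finite_nbrs[OF ME])
      then show ?thesis
        using card_nbrs_le[of u] that S by auto
    qed
  qed
  then have "c_matching S {e \<in> E. e \<subseteq> S} c ?N'"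
    using ME pq by (auto simp: c_matching_def)
  from game_value_ge[OF this] have "sum w ?N' \<le> \<nu> S" .
  moreover have "finite ?N"
    by (rule finite_subset[OF _ finE]) (use ME in auto)
  then have "sum w ?N' = w {p, q} + sum w ?N"
    using pq by (subst sum.insert) auto
  ultimately show ?thesis
    using sum_alloc[OF S] by simp
qed

lemma card_nbrs_cut:
  assumes "u \<in> V" "{u, y} \<in> M" "y \<notin> S"
  shows "card (nbrs M u \<inter> S) < c u"
proof -
  have "card (nbrs M u \<inter> S) < card (nbrs M u)"
    by (rule psubset_card_mono[OF finite_nbrs[OF ME]]) (use assms in \<open>auto simp: nbrs_def\<close>)
  then show ?thesis
    using card_nbrs_le[OF assms(1)] by simp
qed

lemma M_comp_of_subset: "u \<in> V \<Longrightarrow> F \<subseteq> M \<Longrightarrow> comp_of F u \<subseteq> V"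
  by (rule comp_of_subset) (use ME edgeE in auto)

lemma surplus_different_components:
  assumes "u \<in> V" "v \<notin> comp_of M u"
  shows "0 \<le> surplus V E w c x u v"
proof -
  have S: "comp_of M u \<subseteq> V" using M_comp_of_subset assms by blast
  have "cut_pairs (comp_of M u) = {}"
    using comp_of_step by (fastforce simp: cut_pairs_def)
  then show ?thesis
    using excess_ge[OF S] surplus_ge[OF S, of u v] assms by simp
qed

lemma surplus_lower_bound:
  assumes acyc: "acyclic_edges M"
    and choice: "outside_choice V E w c M z best weak"
    and good: "\<not> bad E w c M z best weak a"
    and ab: "{a, b} \<in> M"
    and u: "(a, u) \<in> (adj (M - {{a, b}}))\<^sup>*" and v: "(b, v) \<in> (adj (M - {{a, b}}))\<^sup>*"
  shows "\<alpha> a - z a b \<le> surplus V E w c x u v"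
proof -
  \<comment> \<open>The side of \<open>a\<close> once \<open>ab\<close> is cut. By acyclicity it
    does not contain \<open>b\<close>, so \<open>ab\<close> is the only contract leaving it.\<close>
  let ?C = "comp_of (M - {{a, b}}) a"
  have aV: "a \<in> V" and bV: "b \<in> V" and neq: "a \<noteq> b"
    using ab ME edgeE[of "{a, b}"] edge_neq by auto
  have C: "?C \<subseteq> V" using M_comp_of_subset aV by auto
  have uC: "u \<in> ?C" using u by (simp add: comp_of_def)
  have bC: "b \<notin> ?C"
    using acyclic_edges_bridge[OF acyc ab neq] by (simp add: comp_of_def)
  have vC: "v \<notin> ?C"
    using bC adj_rtrancl_sym[OF v] by (auto simp: comp_of_def intro: rtrancl_trans)
  have exitC: "p = a \<and> y = b" if "p \<in> ?C" "y \<notin> ?C" "{p, y} \<in> M" for p y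
    using that comp_of_step[of p "M - {{a, b}}" a y] bC by (auto simp: doubleton_eq_iff)
  \<comment> \<open>All that the part of \<open>S\<close> around \<open>v'\<close> has to avoid lies
    in the component of \<open>b\<close>; it suffices that \<open>v'\<close> is not in it.\<close>
  have comp_b: "(b, p) \<in> (adj M)\<^sup>*" if "p \<in> insert v (insert b ?C)" for p
  proof -
    have "(b, a) \<in> (adj M)\<^sup>*" using ab by (auto simp: insert_commute)
    moreover have "(b, v) \<in> (adj M)\<^sup>*"
      using v by (rule adj_rtrancl_mono[rotated]) auto
    moreover have "(a, q) \<in> (adj M)\<^sup>*" if "q \<in> ?C" for q
      using that adj_rtrancl_mono[of "M - {{a, b}}" M a q] by (auto simp: comp_of_def)
    ultimately show ?thesis
      using that rtrancl_trans[of b a "adj M" p] by auto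
  qed
  show ?thesis
  proof (cases "0 < \<alpha> a")
    case False
    \<comment> \<open>Here \<open>\<alpha> a = 0\<close>, and \<open>?C\<close> alone already has
      excess at least \<open>- z a b\<close>.\<close>
    have "cut_pairs ?C = {(a, b)}"
      using exitC bC ab by (auto simp: cut_pairs_def)
    then show ?thesis
      using excess_ge[OF C] surplus_ge[OF C uC vC] False outside_option_nonneg[of a] by simp
  next
    case True
    define v' where "v' = best a"
    have edge: "{a, v'} \<in> E - M" and off: "offer w c M z a v' = ereal (\<alpha> a)"
      and weak: "saturated c M v' \<Longrightarrow> {v', weak a} \<in> M \<and> (\<forall>y\<in>nbrs M v'. z v' (weak a) \<le> z v' y)"
      using choice True aV by (auto simp: outside_choice_def v'_def nbrs_def)
    have v'V: "v' \<in> V" using edge edgeE by auto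
    \<comment> \<open>A path from \<open>b\<close> to \<open>v'\<close> would make \<open>a\<close>
      bad by condition (i), with \<open>b\<close> as the neighbour.\<close>
    have sep: "(b, v') \<notin> (adj M)\<^sup>*"
    proof
      assume "(b, v') \<in> (adj M)\<^sup>*"
      from rtrancl_imp_path_between[OF this] obtain p where "path_between M b p v'" ..
      then show False
        using good True ab by (auto simp: bad_def v'_def nbrs_def)
    qed
    have sep': "p \<notin> insert v (insert b ?C)" if "(v', p) \<in> (adj M)\<^sup>*" for p
      using comp_b that sep adj_rtrancl_sym by (meson rtrancl_trans)
    show ?thesis
    proof (cases "saturated c M v'")
      case False
      \<comment> \<open>With spare capacity, \<open>v'\<close> brings its whole component, and no
        second contract is cut.\<close>
      let ?D = "comp_of M v'"
      let ?S = "?C \<union> ?D"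
      have S: "?S \<subseteq> V" using C M_comp_of_subset[OF v'V] by auto
      have D: "p \<notin> insert v (insert b ?C)" if "p \<in> ?D" for p
        using sep' that by (auto simp: comp_of_def)
      have "cut_pairs ?S = {(a, b)}"
        using exitC D bC ab comp_of_step[of _ M v'] by (fastforce simp: cut_pairs_def)
      moreover have "card (nbrs M v' \<inter> ?S) < c v'"
      proof -
        have "card (nbrs M v' \<inter> ?S) \<le> card (nbrs M v')"
          by (intro card_mono finite_nbrs[OF ME]) auto
        then show ?thesis
          using False card_nbrs_le[OF v'V] by (simp add: saturated_def)
      qed
      moreover have "card (nbrs M a \<inter> ?S) < c a"
        using card_nbrs_cut[OF aV ab] bC D by blast
      ultimately have "w {a, v'} - z a b \<le> \<nu> ?S - sum x ?S"
        using excess_ge_new_edge[OF S edge] by simp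
      moreover have "w {a, v'} = \<alpha> a"
        using off False by (simp add: offer_def switch_cost_def)
      moreover have "\<nu> ?S - sum x ?S \<le> surplus V E w c x u v"
        using surplus_ge[OF S] uC vC D by blast
      ultimately show ?thesis by simp
    next
      case True
      define u' where "u' = weak a"
      have v'u': "{v', u'} \<in> M" and min: "\<And>y. y \<in> nbrs M v' \<Longrightarrow> z v' u' \<le> z v' y"
        using weak[OF True] by (auto simp: u'_def)
      have neq': "v' \<noteq> u'" using v'u' ME edge_neq by auto
      \<comment> \<open>Cutting \<open>v'u'\<close> makes room at \<open>v'\<close> for exactly the
        price deducted in the offer to \<open>a\<close>.\<close>
      let ?D = "comp_of (M - {{v', u'}}) v'"
      let ?S = "?C \<union> ?D"
      have S: "?S \<subseteq> V" using C M_comp_of_subset[OF v'V] by auto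
      have "(v', p) \<in> (adj M)\<^sup>*" if "p \<in> ?D" for p
        using that adj_rtrancl_mono[of "M - {{v', u'}}" M v' p] by (auto simp: comp_of_def)
      then have D: "p \<notin> insert v (insert b ?C)" if "p \<in> ?D" for p
        using sep' that by blast
      have u'C: "u' \<notin> ?C"
        using sep'[OF r_into_rtrancl, of u'] v'u' by simp
      have u'D: "u' \<notin> ?D"
        using acyclic_edges_bridge[OF acyc v'u' neq'] by (simp add: comp_of_def)
      have exitD: "p = v' \<and> y = u'" if "p \<in> ?D" "y \<notin> ?D" "{p, y} \<in> M" for p y
        using that comp_of_step[of p "M - {{v', u'}}" v' y] u'D by (auto simp: doubleton_eq_iff)
      have "cut_pairs ?S = {(a, b), (v', u')}"
      proof
        show "cut_pairs ?S \<subseteq> {(a, b), (v', u')}"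
          using exitC exitD by (fastforce simp: cut_pairs_def)
        show "{(a, b), (v', u')} \<subseteq> cut_pairs ?S"
          using ab v'u' bC u'C u'D D by (auto simp: cut_pairs_def)
      qed
      \<comment> \<open>This makes the two cut pairs distinct, so both shares are
        subtracted.\<close>
      moreover have "a \<noteq> v'" using edge edge_neq by auto
      moreover have "card (nbrs M v' \<inter> ?S) < c v'"
        using card_nbrs_cut[OF v'V v'u'] u'C u'D by blast
      moreover have "card (nbrs M a \<inter> ?S) < c a"
        using card_nbrs_cut[OF aV ab] bC D by blast
      ultimately have "w {a, v'} - (z a b + z v' u') \<le> \<nu> ?S - sum x ?S"
        using excess_ge_new_edge[OF S edge] by simp
      moreover have "switch_cost c M z v' = ereal (z v' u')"
        unfolding switch_cost_def using True v'u' min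
        by (auto intro!: antisym INF_lower2[of u'] INF_greatest simp: nbrs_def)
      then have "w {a, v'} - z v' u' = \<alpha> a"
        using off by (simp add: offer_def)
      moreover have "\<nu> ?S - sum x ?S \<le> surplus V E w c x u v"
        using surplus_ge[OF S] uC vC D by blast
      ultimately show ?thesis by simp
    qed
  qed
qed

end

section \<open>Balanced solutions and the prekernel\<close>

theorem theorem1:
  fixes V :: "'a set" and E M :: "'a set set" and w :: "'a set \<Rightarrow> real" and c :: "'a \<Rightarrow> nat"
    and x :: "'a \<Rightarrow> real" and z :: "'a \<Rightarrow> 'a \<Rightarrow> real" and best weak :: "'a \<Rightarrow> 'a"
  assumes "bargaining_instance V E w c"
    and "x \<in> core V E w c"
    and "stable_solution V E w c M z"
    and "\<forall>u\<in>V. x u = (\<Sum>v\<in>nbrs M u. z u v)"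
    and "acyclic_edges M"
    and "outside_choice V E w c M z best weak"
    and "\<forall>u\<in>V. \<not> bad E w c M z best weak u"
  shows "balanced_solution V E w c M z \<longleftrightarrow> x \<in> prekernel V E w c"
proof -
  interpret stable_allocation V E w c M z x
    by unfold_locales (use assms in auto)
  let ?s = "surplus V E w c x"
  have ends: "a \<in> V \<and> b \<in> V \<and> a \<noteq> b" if "{a, b} \<in> M" for a b
    using that ME edgeE[of "{a, b}"] edge_neq by auto
  have lower: "\<alpha> a - z a b \<le> ?s u v"
    if "{a, b} \<in> M" "(a, u) \<in> (adj (M - {{a, b}}))\<^sup>*" "(b, v) \<in> (adj (M - {{a, b}}))\<^sup>*" for a b u v
    using surplus_lower_bound[OF assms(5,6) _ that] assms(7) ends[OF that(1)] by blast
  \<comment> \<open>For the two ends of a contract the upper and the lower bound meet.\<close>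
  have on_edge: "?s a b = \<alpha> a - z a b" if "{a, b} \<in> M" for a b
    using surplus_le[of a b] excess_le[OF that] lower[OF that] ends[OF that]
    by (intro antisym) auto
  show ?thesis
  proof
    assume bal: "balanced_solution V E w c M z"
    have "?s u v \<le> ?s v u" if uv: "u \<in> V" "v \<in> V" "u \<noteq> v" for u v
    proof (cases "v \<in> comp_of M u")
      case True
      show ?thesis
      proof (rule surplus_le[OF uv(1,3)])
        fix S assume S: "S \<subseteq> V" "u \<in> S" "v \<notin> S"
        \<comment> \<open>The contract by which a path from \<open>u\<close> to \<open>v\<close>
          leaves \<open>S\<close> bounds the excess of \<open>S\<close> from above; reversed, it
          bounds \<open>?s v u\<close> from below. Balance equates the two bounds.\<close>
        then obtain a b where ab: "{a, b} \<in> M" "a \<in> S" "b \<notin> S"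
          "(a, u) \<in> (adj (M - {{a, b}}))\<^sup>*" "(b, v) \<in> (adj (M - {{a, b}}))\<^sup>*"
          using exit_edge[of u v M S] True by (auto simp: comp_of_def)
        have "\<nu> S - sum x S \<le> \<alpha> a - z a b"
          using excess_le ab S by blast
        also have "\<dots> = \<alpha> b - z b a"
          using bal ab(1) unfolding balanced_solution_def by (smt (verit))
        also have "\<dots> \<le> ?s v u"
          using lower[of b a v u] ab by (simp add: insert_commute)
        finally show "\<nu> S - sum x S \<le> ?s v u" .
      qed
    next
      case False
      \<comment> \<open>In the core no excess is positive, while the component of \<open>v\<close>
        breaks no contract and so has excess at least 0.\<close>
      have "?s u v \<le> 0"
        using assms(2) by (intro surplus_le[OF uv(1,3)]) (auto simp: core_def)
      also have "0 \<le> ?s v u"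
        using surplus_different_components[OF uv(2), of u] False adj_rtrancl_sym[of v u M]
        by (auto simp: comp_of_def)
      finally show ?thesis .
    qed
    then show "x \<in> prekernel V E w c"
      using assms(2) by (auto simp: prekernel_def core_def intro!: antisym)
  next
    assume pre: "x \<in> prekernel V E w c"
    have "z a b - \<alpha> a = z b a - \<alpha> b" if "{a, b} \<in> M" for a b
    proof -
      have "?s a b = ?s b a"
        using pre ends[OF that] unfolding prekernel_def by blast
      then show ?thesis
        using on_edge[of a b] on_edge[of b a] that by (simp add: insert_commute)
    qed
    then show "balanced_solution V E w c M z"
      using assms(3) unfolding balanced_solution_def by blast
  qed
qed

end
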